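(* The set $R=\{csd(H,G)\mid G \text{ a finite group},\ H\in L(G)\}$ is dense in $[0,1]$.
   Context: For a finite group $G$, $L(G)$ denotes the set of all subgroups of $G$ and $L_1(G)$ the set of all cyclic subgroups of $G$. For $H\in L(G)$, the relative cyclic subgroup commutativity degree of $H$ in $G$ is $$csd(H,G)=\frac{1}{|L_1(H)||L_1(G)|}\left|\{(H_1,G_1)\in L_1(H)\times L_1(G) \mid H_1G_1=G_1H_1\}\right|.$$ *)

theory Defs
  imports "HOL-Analysis.Analysis" "HOL-Algebra.Elementary_Groups"
begin

definition cyclic_subgroups :: "'a monoid \<Rightarrow> 'a set set" where
  "cyclic_subgroups G = {C. subgroup C G \<and> cyclic_group (G\<lparr>carrier := C\<rparr>)}"

definition csd :: "'a set \<Rightarrow> 'a monoid \<Rightarrow> real" where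
  "csd H G =
     real (card {(H1, G1) \<in> cyclic_subgroups (G\<lparr>carrier := H\<rparr>) \<times> cyclic_subgroups G.
                   H1 <#>\<^bsub>G\<^esub> G1 = G1 <#>\<^bsub>G\<^esub> H1})
     / (real (card (cyclic_subgroups (G\<lparr>carrier := H\<rparr>))) * real (card (cyclic_subgroups G)))"

text \<open>
  HOL cannot quantify over all types inside a set comprehension, so the groups below have their
  elements among the natural numbers. Every finite group is isomorphic to such a group, hence no
  value is lost: see \<open>csd_in_csd_values\<close>, where the type of the group elements is arbitrary.
\<close>

definition csd_values :: "real set" where
  "csd_values = {csd H G | (G :: nat monoid) H. group G \<and> finite (carrier G) \<and> subgroup H G}"

lemma bij_betw_cyclic_subgroups:
  assumes "group G" "group K" and f: "f \<in> iso G K"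
  shows "bij_betw ((`) f) (cyclic_subgroups G) (cyclic_subgroups K)"
proof -
  have img: "h ` A \<in> cyclic_subgroups N"
    if gM: "group M" and gN: "group N" and h: "h \<in> iso M N" and A: "A \<in> cyclic_subgroups M"
    for A :: "'x set" and h :: "'x \<Rightarrow> 'y" and M N
  proof -
    interpret M: group M by fact
    interpret N: group N by fact
    interpret group_hom M N h
      using h by unfold_locales (auto simp: iso_def)
    have sA: "subgroup A M" and cA: "cyclic_group (M\<lparr>carrier := A\<rparr>)"
      using A by (auto simp: cyclic_subgroups_def)
    have sB: "subgroup (h ` A) N"
      using sA by (rule subgroup_img_is_subgroup)
    have sub: "A \<subseteq> carrier M" using sA by (rule subgroup.subset)
    have "h \<in> iso (M\<lparr>carrier := A\<rparr>) (N\<lparr>carrier := h ` A\<rparr>)"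
      using h sub by (auto simp: iso_def bij_betw_def hom_def inj_on_subset subset_iff)
    then have "M\<lparr>carrier := A\<rparr> \<cong> N\<lparr>carrier := h ` A\<rparr>"
      by (rule is_isoI)
    moreover have "group (M\<lparr>carrier := A\<rparr>)" "group (N\<lparr>carrier := h ` A\<rparr>)"
      using sA sB M.subgroup_imp_group N.subgroup_imp_group by auto
    ultimately have "cyclic_group (N\<lparr>carrier := h ` A\<rparr>)"
      using cA isomorphic_group_cyclicity by blast
    with sB show ?thesis by (simp add: cyclic_subgroups_def)
  qed
  let ?g = "inv_into (carrier G) f"
  have g: "?g \<in> iso K G"
    using assms by (simp add: group.iso_set_sym)
  have bij: "bij_betw f (carrier G) (carrier K)"
    using f by (simp add: iso_def)
  have subG: "A \<subseteq> carrier G" if "A \<in> cyclic_subgroups G" for A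
    using that by (auto simp: cyclic_subgroups_def dest: subgroup.subset)
  have subK: "A \<subseteq> carrier K" if "A \<in> cyclic_subgroups K" for A
    using that by (auto simp: cyclic_subgroups_def dest: subgroup.subset)
  show ?thesis
  proof (rule bij_betw_byWitness[where f' = "(`) ?g"])
    show "\<forall>A\<in>cyclic_subgroups G. ?g ` f ` A = A"
      using bij subG by (meson bij_betw_imp_inj_on inv_into_image_cancel)
    show "\<forall>B\<in>cyclic_subgroups K. f ` ?g ` B = B"
      using bij subK by (simp add: bij_betw_def image_inv_into_cancel)
    show "(`) f ` cyclic_subgroups G \<subseteq> cyclic_subgroups K"
      using img[OF assms(1,2) f] by auto
    show "(`) ?g ` cyclic_subgroups K \<subseteq> cyclic_subgroups G"
      using img[OF assms(2,1) g] by auto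
  qed
qed

lemma csd_iso_invariant:
  assumes G: "group G" and K: "group K" and f: "f \<in> iso G K" and H: "subgroup H G"
  shows "csd (f ` H) K = csd H G"
proof -
  interpret G: group G by fact
  interpret K: group K by fact
  interpret group_hom G K f
    using f by unfold_locales (auto simp: iso_def)
  let ?GH = "G\<lparr>carrier := H\<rparr>" and ?KH = "K\<lparr>carrier := f ` H\<rparr>"
  have inj: "inj_on f (carrier G)"
    using f by (simp add: iso_def bij_betw_def)
  have HG: "H \<subseteq> carrier G" using H by (rule subgroup.subset)
  have "f \<in> iso ?GH ?KH"
    using f HG by (auto simp: iso_def bij_betw_def hom_def inj_on_subset subset_iff)
  moreover have "group ?GH" "group ?KH"
    using H G.subgroup_imp_group K.subgroup_imp_group subgroup_img_is_subgroup by auto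
  ultimately have bH: "bij_betw ((`) f) (cyclic_subgroups ?GH) (cyclic_subgroups ?KH)"
    by (intro bij_betw_cyclic_subgroups)
  have bG: "bij_betw ((`) f) (cyclic_subgroups G) (cyclic_subgroups K)"
    using G K f by (rule bij_betw_cyclic_subgroups)
  have subG: "A \<subseteq> carrier G" if "A \<in> cyclic_subgroups G" for A
    using that by (auto simp: cyclic_subgroups_def dest: subgroup.subset)
  have subH: "A \<subseteq> carrier G" if "A \<in> cyclic_subgroups ?GH" for A
    using that HG by (fastforce simp: cyclic_subgroups_def dest: subgroup.subset)
  have mult: "f ` A <#>\<^bsub>K\<^esub> f ` B = f ` (A <#>\<^bsub>G\<^esub> B)"
    if "A \<subseteq> carrier G" "B \<subseteq> carrier G" for A B
    using that set_mult_hom[OF homh] by simp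
  have perm: "f ` A <#>\<^bsub>K\<^esub> f ` B = f ` B <#>\<^bsub>K\<^esub> f ` A \<longleftrightarrow> A <#>\<^bsub>G\<^esub> B = B <#>\<^bsub>G\<^esub> A"
    if "A \<subseteq> carrier G" "B \<subseteq> carrier G" for A B
    using that inj by (simp add: mult inj_on_image_eq_iff G.set_mult_closed)
  let ?P = "{(A, B) \<in> cyclic_subgroups ?GH \<times> cyclic_subgroups G. A <#>\<^bsub>G\<^esub> B = B <#>\<^bsub>G\<^esub> A}"
  let ?Q = "{(A, B) \<in> cyclic_subgroups ?KH \<times> cyclic_subgroups K. A <#>\<^bsub>K\<^esub> B = B <#>\<^bsub>K\<^esub> A}"
  let ?F = "map_prod ((`) f) ((`) f)"
  have bP: "bij_betw ?F (cyclic_subgroups ?GH \<times> cyclic_subgroups G)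
      (cyclic_subgroups ?KH \<times> cyclic_subgroups K)"
    using bH bG by (rule bij_betw_map_prod)
  have "?F ` ?P = ?Q"
  proof
    show "?F ` ?P \<subseteq> ?Q"
    proof
      fix q assume "q \<in> ?F ` ?P"
      then obtain A B where AB: "A \<in> cyclic_subgroups ?GH" "B \<in> cyclic_subgroups G"
          "A <#>\<^bsub>G\<^esub> B = B <#>\<^bsub>G\<^esub> A" and q: "q = (f ` A, f ` B)"
        by (elim imageE CollectE case_prodE) (simp only: map_prod_simp mem_Sigma_iff, blast)
      have "f ` A \<in> cyclic_subgroups ?KH" "f ` B \<in> cyclic_subgroups K"
        using AB bij_betwE[OF bH] bij_betwE[OF bG] by blast+
      moreover have "f ` A <#>\<^bsub>K\<^esub> f ` B = f ` B <#>\<^bsub>K\<^esub> f ` A"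
        using perm[OF subH subG] AB by blast
      ultimately show "q \<in> ?Q"
        unfolding q by blast
    qed
    show "?Q \<subseteq> ?F ` ?P"
    proof
      fix q assume q: "q \<in> ?Q"
      then obtain X Y where XY: "X \<in> cyclic_subgroups ?KH" "Y \<in> cyclic_subgroups K"
          "X <#>\<^bsub>K\<^esub> Y = Y <#>\<^bsub>K\<^esub> X" "q = (X, Y)"
        by blast
      obtain A where A: "A \<in> cyclic_subgroups ?GH" "X = f ` A"
        using XY(1) bij_betw_imp_surj_on[OF bH] by blast
      obtain B where B: "B \<in> cyclic_subgroups G" "Y = f ` B"
        using XY(2) bij_betw_imp_surj_on[OF bG] by blast
      have "A <#>\<^bsub>G\<^esub> B = B <#>\<^bsub>G\<^esub> A"
        using XY(3) perm[OF subH[OF A(1)] subG[OF B(1)]] unfolding A(2) B(2) by blast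
      then have "(A, B) \<in> ?P"
        using A(1) B(1) by blast
      moreover have "q = ?F (A, B)"
        using XY(4) A(2) B(2) by simp
      ultimately show "q \<in> ?F ` ?P"
        by (rule rev_image_eqI)
    qed
  qed
  moreover have "inj_on ?F ?P"
    by (rule inj_on_subset[OF bij_betw_imp_inj_on[OF bP]]) auto
  ultimately have "card ?Q = card ?P"
    by (metis (no_types, lifting) card_image)
  then show ?thesis
    using bij_betw_same_card[OF bH] bij_betw_same_card[OF bG] by (simp add: csd_def)
qed

theorem csd_in_csd_values:
  fixes G :: "'a monoid"
  assumes G: "group G" and fin: "finite (carrier G)" and H: "subgroup H G"
  shows "csd H G \<in> csd_values"
proof -
  interpret G: group G by fact
  obtain f :: "'a \<Rightarrow> nat" where inj: "inj_on f (carrier G)"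
    using finite_imp_inj_to_nat_seg[OF fin] by blast
  let ?g = "inv_into (carrier G) f"
  define K where "K = \<lparr>carrier = f ` carrier G,
    monoid.mult = \<lambda>a b. f (?g a \<otimes>\<^bsub>G\<^esub> ?g b), one = f \<one>\<^bsub>G\<^esub>\<rparr>"
  have f: "f \<in> iso G K"
    using inj by (auto simp: iso_def hom_def K_def bij_betw_def)
  have "group (K\<lparr>carrier := f ` carrier G, one := f \<one>\<^bsub>G\<^esub>\<rparr>)"
    using f by (intro G.hom_imp_img_group) (simp add: iso_def)
  then have K: "group K" by (simp add: K_def)
  interpret K: group K by fact
  interpret group_hom G K f
    using f by unfold_locales (auto simp: iso_def)
  have "csd (f ` H) K = csd H G"
    using G K f H by (rule csd_iso_invariant)
  moreover have "subgroup (f ` H) K" using H by (rule subgroup_img_is_subgroup)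
  moreover have "finite (carrier K)" unfolding K_def by (simp add: fin)
  ultimately have "csd H G = csd (f ` H) K \<and> group K \<and> finite (carrier K) \<and> subgroup (f ` H) K"
    using K by metis
  then show ?thesis
    unfolding csd_values_def by blast
qed

end

theory Submission
  imports Defs "HOL-Algebra.Multiplicative_Group" "HOL-Number_Theory.Cong" "HOL-Real_Asymp.Real_Asymp"
begin

text \<open>
  Let the cyclic group of order \<open>2 ^ k\<close> act on the cyclic group of odd order \<open>N\<close> through
  inversion, and let \<open>G\<close> be the semidirect product. The cyclic subgroups of \<open>G\<close> are of two kinds.
  Those inside the cyclic subgroup of index two are normal, hence permute with every subgroup; a
  choice of a divisor of \<open>N\<close> and of an even divisor of \<open>2 ^ k\<close> gives one of them, so there are
  \<open>k \<tau>(N)\<close>. The remaining ones are the \<open>N\<close> Sylow 2-subgroups. If two of these permute, their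
  product is a 2-group containing both, so they are equal.

  For \<open>N = t s\<close> the elements whose component of odd order is a multiple of \<open>t\<close> form a subgroup
  \<open>H t\<close>. It is a group of the same shape with \<open>s\<close> in the place of \<open>N\<close>, so it has \<open>k \<tau>(s)\<close>
  normal cyclic subgroups and \<open>s\<close> Sylow 2-subgroups, and its degree in \<open>G\<close> can be read off
  (\<open>csd_H\<close>). When \<open>s\<close> and \<open>k\<close> are fixed and \<open>N\<close> grows through powers of 3, \<open>\<tau>(N) / N\<close> tends to 0:
  almost all cyclic subgroups of \<open>G\<close> are Sylow 2-subgroups, and a Sylow 2-subgroup of \<open>H t\<close>
  permutes with almost none of these. Hence the degree tends to the proportion
  \<open>k \<tau>(s) / (k \<tau>(s) + s)\<close> of normal subgroups among the cyclic subgroups of \<open>H t\<close>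
  (\<open>ratio_in_closure\<close>).

  For \<open>s = 3 ^ a\<close> this proportion is \<open>u / (u + 1)\<close> with \<open>u = k (a + 1) / 3 ^ a\<close>. For large \<open>a\<close>
  the multiples of \<open>(a + 1) / 3 ^ a\<close> form a fine grid, so \<open>u\<close> can be brought as close as desired to
  any positive number by the choice of \<open>k\<close>, and \<open>u / (u + 1)\<close> to any number of the open unit
  interval (\<open>open_unit_interval_in_closure\<close>).
\<close>

section \<open>Cyclic subgroups and the range of the degree\<close>

lemma cyclic_subgroups_eq_generate:
  fixes G :: "'a monoid" (structure)
  assumes "group G"
  shows "cyclic_subgroups G = (\<lambda>x. generate G {x}) ` carrier G"
proof -
  interpret group G by fact
  have "C \<in> cyclic_subgroups G \<longleftrightarrow> (\<exists>x\<in>carrier G. C = generate G {x})" for C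
  proof
    assume "C \<in> cyclic_subgroups G"
    then have C: "subgroup C G" and cyc: "cyclic_group (G\<lparr>carrier := C\<rparr>)"
      by (auto simp: cyclic_subgroups_def)
    interpret GC: group "G\<lparr>carrier := C\<rparr>"
      using C by (rule subgroup_imp_group)
    obtain x where x: "x \<in> C" "C = range (\<lambda>n::int. x [^]\<^bsub>G\<lparr>carrier := C\<rparr>\<^esub> n)"
      using cyc by (auto simp: GC.cyclic_group)
    have "x \<in> carrier G"
      using C x(1) by (rule subgroup.mem_carrier)
    moreover have "C = range (\<lambda>n::int. x [^] n)"
      using x(2) unfolding int_pow_consistent[OF C x(1), symmetric] .
    moreover have "range (\<lambda>n::int. x [^] n) = generate G {x}"
      unfolding generate_pow[OF \<open>x \<in> carrier G\<close>] by auto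
    ultimately show "\<exists>x\<in>carrier G. C = generate G {x}" by blast
  next
    assume "\<exists>x\<in>carrier G. C = generate G {x}"
    then obtain x where x: "x \<in> carrier G" and C: "C = generate G {x}" by blast
    have "cyclic_group (subgroup_generated G {x})"
      by (rule cyclic_group_generated)
    then show "C \<in> cyclic_subgroups G"
      using x C generate_is_subgroup[of "{x}"]
      by (simp add: cyclic_subgroups_def subgroup_generated_def Int_absorb1)
  qed
  then show ?thesis by auto
qed

lemma cyclic_subgroups_of_subgroup:
  assumes "group G" and H: "subgroup H G"
  shows "cyclic_subgroups (G\<lparr>carrier := H\<rparr>) = {C \<in> cyclic_subgroups G. C \<subseteq> H}"
proof -
  interpret group G by fact
  have "subgroup C (G\<lparr>carrier := H\<rparr>) \<longleftrightarrow> subgroup C G \<and> C \<subseteq> H" for C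
    using incl_subgroup[OF H, of C] subgroup_incl[OF _ H, of C]
      subgroup.subset[of C "G\<lparr>carrier := H\<rparr>"] by auto
  then show ?thesis by (auto simp: cyclic_subgroups_def)
qed

lemma finite_cyclic_subgroups:
  assumes "finite (carrier G)"
  shows "finite (cyclic_subgroups G)"
proof (rule finite_subset)
  show "cyclic_subgroups G \<subseteq> Pow (carrier G)"
    by (auto simp: cyclic_subgroups_def dest: subgroup.subset)
qed (simp add: assms)

lemma csd_bounds:
  assumes "group G" "finite (carrier G)" "subgroup H G"
  shows "csd H G \<in> {0..1}"
proof -
  let ?LH = "cyclic_subgroups (G\<lparr>carrier := H\<rparr>)" and ?LG = "cyclic_subgroups G"
  let ?S = "{(A, B) \<in> ?LH \<times> ?LG. A <#>\<^bsub>G\<^esub> B = B <#>\<^bsub>G\<^esub> A}"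
  have "finite H"
    using assms(2,3) by (meson finite_subset subgroup.subset)
  then have "finite ?LH" "finite ?LG"
    using assms by (auto intro: finite_cyclic_subgroups)
  then have "card ?S \<le> card (?LH \<times> ?LG)"
    by (intro card_mono) auto
  then have "real (card ?S) \<le> real (card ?LH) * real (card ?LG)"
    by (simp add: card_cartesian_product flip: of_nat_mult)
  then show ?thesis
    by (auto simp: csd_def intro!: divide_le_eq_1[THEN iffD2] mult_nonneg_nonneg)
qed

text \<open>
  In the numerator, a subgroup from \<open>\<A>\<close> inside \<open>H\<close> contributes all cyclic subgroups of the group,
  and one from \<open>\<B>\<close> contributes the members of \<open>\<A>\<close> and itself.
\<close>

lemma csd_of_permuting_split:
  fixes G :: "'a monoid" (structure)
  assumes G: "group G" and fin: "finite (carrier G)" and H: "subgroup H G"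
    and split: "cyclic_subgroups G = \<A> \<union> \<B>" "\<A> \<inter> \<B> = {}"
    and perm: "\<And>C D. C \<in> \<A> \<Longrightarrow> D \<in> cyclic_subgroups G \<Longrightarrow> C <#> D = D <#> C"
    and rigid: "\<And>C D. C \<in> \<B> \<Longrightarrow> D \<in> \<B> \<Longrightarrow> C <#> D = D <#> C \<Longrightarrow> C = D"
  defines "a \<equiv> real (card \<A>)" and "b \<equiv> real (card \<B>)"
    and "a' \<equiv> real (card {C \<in> \<A>. C \<subseteq> H})" and "b' \<equiv> real (card {C \<in> \<B>. C \<subseteq> H})"
  shows "csd H G = (a' * (a + b) + b' * (a + 1)) / ((a' + b') * (a + b))"
proof -
  let ?A' = "{C \<in> \<A>. C \<subseteq> H}" and ?B' = "{C \<in> \<B>. C \<subseteq> H}"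
  have finAB: "finite \<A>" "finite \<B>"
    using finite_cyclic_subgroups[OF fin] split(1) by auto
  have LH: "cyclic_subgroups (G\<lparr>carrier := H\<rparr>) = ?A' \<union> ?B'"
    using cyclic_subgroups_of_subgroup[OF G H] split(1) by auto
  let ?S = "{(C, D) \<in> cyclic_subgroups (G\<lparr>carrier := H\<rparr>) \<times> cyclic_subgroups G. C <#> D = D <#> C}"
  have S: "?S = (?A' \<times> (\<A> \<union> \<B>)) \<union> ((?B' \<times> \<A>) \<union> (\<lambda>C. (C, C)) ` ?B')"
  proof -
    have "C <#> D = D <#> C \<longleftrightarrow> C \<in> \<A> \<or> D \<in> \<A> \<or> C = D"
      if "C \<in> \<A> \<union> \<B>" "D \<in> \<A> \<union> \<B>" for C D
      using that perm[of C D] perm[of D C] rigid[of C D] unfolding split(1) by auto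
    then show ?thesis unfolding LH split(1) by auto
  qed
  have "card ?S = card (?A' \<times> (\<A> \<union> \<B>)) + card ((?B' \<times> \<A>) \<union> (\<lambda>C. (C, C)) ` ?B')"
    unfolding S using finAB split(2) by (intro card_Un_disjoint) auto
  also have "card ((?B' \<times> \<A>) \<union> (\<lambda>C. (C, C)) ` ?B') = card (?B' \<times> \<A>) + card ((\<lambda>C. (C, C)) ` ?B')"
    using finAB split(2) by (intro card_Un_disjoint) auto
  also have "card ((\<lambda>C. (C, C)) ` ?B') = card ?B'"
    by (intro card_image) (auto simp: inj_on_def)
  also have "card (?A' \<times> (\<A> \<union> \<B>)) = card ?A' * (card \<A> + card \<B>)"
    using finAB split(2) by (simp add: card_cartesian_product card_Un_disjoint)
  finally have "real (card ?S) = a' * (a + b) + b' * (a + 1)"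
    by (simp add: card_cartesian_product a_def b_def a'_def b'_def algebra_simps)
  moreover have "real (card (cyclic_subgroups (G\<lparr>carrier := H\<rparr>))) = a' + b'"
    unfolding LH a'_def b'_def using finAB split(2) by (subst card_Un_disjoint) auto
  moreover have "real (card (cyclic_subgroups G)) = a + b"
    unfolding split(1) a_def b_def using finAB split(2) by (subst card_Un_disjoint) auto
  ultimately show ?thesis
    by (simp add: csd_def)
qed

section \<open>Inversion extensions of odd cyclic groups\<close>

text \<open>
  With \<open>a = b\<close> this counts all divisors of \<open>p ^ b\<close> and, if \<open>b > 0\<close>, with \<open>a = b - 1\<close> those
  divisible by \<open>p\<close>.
\<close>

lemma card_divisors_prime_power_above:
  fixes p :: int
  assumes p: "prime p" and "a \<le> b"
  shows "card {d. 0 < d \<and> d dvd p ^ b \<and> p ^ (b - a) dvd d} = a + 1"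
proof -
  have p1: "1 < p" using p by (rule prime_gt_1_int)
  have "{d. 0 < d \<and> d dvd p ^ b \<and> p ^ (b - a) dvd d} = (\<lambda>i. p ^ i) ` {b - a..b}" (is "?L = ?R")
  proof
    show "?L \<subseteq> ?R"
    proof
      fix d assume d: "d \<in> ?L"
      then have "d dvd p ^ b" by simp
      then obtain i where i: "i \<le> b" "normalize d = p ^ i"
        by (rule divides_primepow[OF p])
      have "normalize d = d" using d by simp
      then have d_eq: "d = p ^ i" using i(2) by (simp only:)
      have "p ^ (b - a) dvd p ^ i" using d unfolding d_eq by simp
      then have "b - a \<le> i" using p1 dvd_power_iff[of p "b - a" i] by simp
      then show "d \<in> ?R" using i(1) d_eq by simp
    qed
  qed (use p1 in \<open>auto intro: le_imp_power_dvd\<close>)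
  moreover have "inj_on (\<lambda>i. p ^ i) {b - a..b}" using p1 by (auto simp: inj_on_def)
  ultimately show ?thesis using assms(2) by (simp add: card_image)
qed

text \<open>
  The pair \<open>(x, y)\<close> stands for the residue classes of \<open>x\<close> modulo \<open>N\<close> and of \<open>y\<close> modulo \<open>2 ^ k\<close>;
  the second component acts on the first by \<open>(-1) ^ y\<close>, which makes sense for residues since
  \<open>2 ^ k\<close> is even.
\<close>

definition inversion_group :: "int \<Rightarrow> nat \<Rightarrow> (int \<times> int) monoid" where
  "inversion_group N k = \<lparr>carrier = {0..<N} \<times> {0..<2 ^ k},
     monoid.mult = (\<lambda>(x, y) (x', y').
       ((x + (if even y then x' else - x')) mod N, (y + y') mod 2 ^ k)),
     one = (0, 0)\<rparr>"

locale inversion_extension =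
  fixes N :: int and k :: nat
  assumes N_pos: "0 < N" and N_odd: "odd N" and k_pos: "0 < k"
begin

abbreviation G where "G \<equiv> inversion_group N k"

lemma carrier_iff: "(x, y) \<in> carrier G \<longleftrightarrow> 0 \<le> x \<and> x < N \<and> 0 \<le> y \<and> y < 2 ^ k"
  by (auto simp: inversion_group_def)

lemma mult_eq:
  "(x, y) \<otimes>\<^bsub>G\<^esub> (x', y') = ((x + (if even y then x' else - x')) mod N, (y + y') mod 2 ^ k)"
  by (simp add: inversion_group_def)

lemma one_eq: "\<one>\<^bsub>G\<^esub> = (0, 0)"
  by (simp add: inversion_group_def)

lemma even_mod_iff: "even (y mod 2 ^ k) \<longleftrightarrow> even (y::int)"
  using k_pos by (intro dvd_mod_iff) simp

lemma two_le: "(2::int) \<le> 2 ^ k"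
  using k_pos by (metis Suc_leI one_le_numeral power_increasing power_one_right One_nat_def)

definition inverse_elem :: "int \<times> int \<Rightarrow> int \<times> int" where
  "inverse_elem g = (if even (snd g) then (- fst g) mod N else fst g, (- snd g) mod 2 ^ k)"

lemma inverse_elem:
  assumes "g \<in> carrier G"
  shows "inverse_elem g \<in> carrier G" "inverse_elem g \<otimes>\<^bsub>G\<^esub> g = \<one>\<^bsub>G\<^esub>"
  using assms N_pos by (cases g; auto simp: inverse_elem_def carrier_iff mult_eq one_eq
      even_mod_iff mod_simps)+

lemma group_G: "group G"
proof (rule groupI)
  show "g \<otimes>\<^bsub>G\<^esub> h \<in> carrier G" if "g \<in> carrier G" "h \<in> carrier G" for g h
    using N_pos by (cases g; cases h) (simp add: mult_eq carrier_iff)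
  show "f \<otimes>\<^bsub>G\<^esub> g \<otimes>\<^bsub>G\<^esub> h = f \<otimes>\<^bsub>G\<^esub> (g \<otimes>\<^bsub>G\<^esub> h)" for f g h
    by (cases f; cases g; cases h) (auto simp: mult_eq even_mod_iff mod_simps algebra_simps)
  show "\<one>\<^bsub>G\<^esub> \<in> carrier G"
    using N_pos by (simp add: one_eq carrier_iff)
  show "\<one>\<^bsub>G\<^esub> \<otimes>\<^bsub>G\<^esub> g = g" if "g \<in> carrier G" for g
    using that by (cases g) (simp add: one_eq mult_eq carrier_iff)
  show "\<exists>h\<in>carrier G. h \<otimes>\<^bsub>G\<^esub> g = \<one>\<^bsub>G\<^esub>" if "g \<in> carrier G" for g
    using inverse_elem[OF that] by blast
qed

sublocale group G by (rule group_G)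

lemma finite_carrier: "finite (carrier G)"
  by (simp add: inversion_group_def)

lemma pow_even:
  assumes "even y" "(x, y) \<in> carrier G"
  shows "(x, y) [^]\<^bsub>G\<^esub> (n::nat) = (int n * x mod N, int n * y mod 2 ^ k)"
  using assms(1)
  by (induction n) (auto simp: one_eq mult_eq even_mod_iff mod_simps algebra_simps)

lemma pow_odd:
  assumes "odd y" "(x, y) \<in> carrier G"
  shows "(x, y) [^]\<^bsub>G\<^esub> (n::nat) = (if even n then 0 else x, int n * y mod 2 ^ k)"
  using assms
  by (induction n) (auto simp: one_eq mult_eq even_mod_iff carrier_iff mod_simps algebra_simps)

text \<open>
  The two kinds of cyclic subgroups. For \<open>d\<close> dividing \<open>N\<close> and an even \<open>e\<close> dividing \<open>2 ^ k\<close>,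
  \<open>rot d e\<close> is the product of the subgroups generated by \<open>d\<close>
  and by \<open>e\<close> in the two factors, and it is cyclic because their orders are coprime; \<open>sylow x\<close> is
  the Sylow 2-subgroup generated by \<open>(x, 1)\<close>.
\<close>

definition rot :: "int \<Rightarrow> int \<Rightarrow> (int \<times> int) set" where
  "rot d e = {(x, y) \<in> carrier G. d dvd x \<and> e dvd y}"

definition sylow :: "int \<Rightarrow> (int \<times> int) set" where
  "sylow x = {(u, v) \<in> carrier G. u = (if even v then 0 else x)}"

lemma generate_eq_powers:
  assumes "g \<in> carrier G"
  shows "generate G {g} = range (\<lambda>n::nat. g [^]\<^bsub>G\<^esub> n)"
  using generate_pow_nat[OF assms] ord_ge_1[OF finite_carrier assms] by auto

text \<open>
  An even second component acts trivially, so powers are taken in both components independently and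
  the Chinese remainder theorem lets the two exponents be prescribed separately.
\<close>

lemma generate_even:
  assumes y: "even y" and g: "(x, y) \<in> carrier G"
  shows "generate G {(x, y)} = rot (gcd x N) (gcd y (2 ^ k))"
proof
  show "generate G {(x, y)} \<subseteq> rot (gcd x N) (gcd y (2 ^ k))"
    using N_pos by (auto simp: generate_eq_powers[OF g] pow_even[OF y g] rot_def carrier_iff dvd_mod_iff)
  show "rot (gcd x N) (gcd y (2 ^ k)) \<subseteq> generate G {(x, y)}"
  proof clarify
    fix u v assume "(u, v) \<in> rot (gcd x N) (gcd y (2 ^ k))"
    then have uv: "(u, v) \<in> carrier G" "gcd x N dvd u" "gcd y (2 ^ k) dvd v"
      by (auto simp: rot_def)
    obtain p q where p: "[x * p = u] (mod N)" and q: "[y * q = v] (mod 2 ^ k)"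
      using uv cong_solve_dvd_int by meson
    have "coprime N (2 ^ k)" using N_odd by simp
    then obtain m where m: "[m = p] (mod N)" "[m = q] (mod 2 ^ k)"
      using binary_chinese_remainder_int by blast
    define n where "n = nat (m mod (N * 2 ^ k))"
    have n: "int n = m mod (N * 2 ^ k)" using N_pos by (simp add: n_def)
    have "[int n = p] (mod N)" "[int n = q] (mod 2 ^ k)"
      using m by (simp_all add: n cong_def mod_mod_cancel)
    then have "[int n * x = u] (mod N)" "[int n * y = v] (mod 2 ^ k)"
      using p q by (metis cong_scalar_left cong_trans mult.commute)+
    then have "(x, y) [^]\<^bsub>G\<^esub> n = (u, v)"
      using uv(1) by (simp add: pow_even[OF y g] cong_def carrier_iff)
    then show "(u, v) \<in> generate G {(x, y)}"
      unfolding generate_eq_powers[OF g] by (metis rangeI)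
  qed
qed

text \<open>
  The square of \<open>(x, y)\<close> has first component \<open>x - x = 0\<close>, so the parity of the exponent determines
  the first component of a power; the second component \<open>y\<close> is a unit modulo \<open>2 ^ k\<close>.
\<close>

lemma generate_odd:
  assumes y: "odd y" and g: "(x, y) \<in> carrier G"
  shows "generate G {(x, y)} = sylow x"
proof
  show "generate G {(x, y)} \<subseteq> sylow x"
    using N_pos g y
    by (auto simp: generate_eq_powers[OF g] pow_odd[OF y g] sylow_def carrier_iff even_mod_iff)
  show "sylow x \<subseteq> generate G {(x, y)}"
  proof clarify
    fix u v assume "(u, v) \<in> sylow x"
    then have uv: "(u, v) \<in> carrier G" "u = (if even v then 0 else x)"
      by (auto simp: sylow_def)
    have "gcd y (2 ^ k) dvd v" using y by (simp add: coprime_imp_gcd_eq_1)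
    then obtain q where q: "[y * q = v] (mod 2 ^ k)"
      using cong_solve_dvd_int by blast
    define n where "n = nat (q mod 2 ^ k)"
    have n: "int n = q mod 2 ^ k" by (simp add: n_def)
    have v: "int n * y mod 2 ^ k = v"
      using q uv(1) by (simp add: n cong_def carrier_iff mod_simps mult.commute)
    then have "even n \<longleftrightarrow> even v"
      using y even_mod_iff[of "int n * y"] by auto
    then have "(x, y) [^]\<^bsub>G\<^esub> n = (u, v)"
      using uv v by (simp add: pow_odd[OF y g])
    then show "(u, v) \<in> generate G {(x, y)}"
      unfolding generate_eq_powers[OF g] by (metis rangeI)
  qed
qed

definition divs :: "int set" where "divs = {d. 0 < d \<and> d dvd N}"
definition even_divs :: "int set" where "even_divs = {e. 0 < e \<and> even e \<and> e dvd 2 ^ k}"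

definition rot_subgroups where "rot_subgroups = (\<lambda>(d, e). rot d e) ` (divs \<times> even_divs)"
definition sylow_subgroups where "sylow_subgroups = sylow ` {0..<N}"

lemma cyclic_subgroups_G: "cyclic_subgroups G = rot_subgroups \<union> sylow_subgroups"
proof
  show "cyclic_subgroups G \<subseteq> rot_subgroups \<union> sylow_subgroups"
  proof
    fix C assume "C \<in> cyclic_subgroups G"
    then obtain x y where xy: "(x, y) \<in> carrier G" and C: "C = generate G {(x, y)}"
      by (auto simp: cyclic_subgroups_eq_generate[OF group_G])
    show "C \<in> rot_subgroups \<union> sylow_subgroups"
    proof (cases "even y")
      case True
      have "gcd x N \<in> divs" "gcd y (2 ^ k) \<in> even_divs"
        using True N_pos k_pos by (auto simp: divs_def even_divs_def)
      then show ?thesis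
        unfolding C generate_even[OF True xy] rot_subgroups_def by blast
    next
      case False
      then show ?thesis
        using xy by (auto simp: C generate_odd sylow_subgroups_def carrier_iff)
    qed
  qed
  show "rot_subgroups \<union> sylow_subgroups \<subseteq> cyclic_subgroups G"
  proof
    fix C assume "C \<in> rot_subgroups \<union> sylow_subgroups"
    then consider d e where "d \<in> divs" "e \<in> even_divs" "C = rot d e" | x where "0 \<le> x" "x < N" "C = sylow x"
      by (auto simp: rot_subgroups_def sylow_subgroups_def)
    then show "C \<in> cyclic_subgroups G"
    proof cases
      case 1
      have g: "(d mod N, e mod 2 ^ k) \<in> carrier G"
        using N_pos by (simp add: carrier_iff)
      have "gcd (d mod N) N = d" "gcd (e mod 2 ^ k) (2 ^ k) = e"
        using 1 N_pos by (auto simp: divs_def even_divs_def gcd_proj1_iff)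
      then have "generate G {(d mod N, e mod 2 ^ k)} = C"
        using generate_even[OF _ g] 1 by (auto simp: even_divs_def even_mod_iff)
      then show ?thesis
        using g by (auto simp: cyclic_subgroups_eq_generate[OF group_G])
    next
      case 2
      have g: "(x, 1) \<in> carrier G"
        using 2 two_le by (simp add: carrier_iff)
      then show ?thesis
        using generate_odd[OF _ g] 2 by (auto simp: cyclic_subgroups_eq_generate[OF group_G])
    qed
  qed
qed

lemma sylow_mem: "0 \<le> x \<Longrightarrow> x < N \<Longrightarrow> (x, 1) \<in> sylow x"
  using two_le by (simp add: sylow_def carrier_iff)

lemma rot_mem:
  assumes "d \<in> divs" "e \<in> even_divs"
  shows "(d mod N, 0) \<in> rot d e" "(0, e mod 2 ^ k) \<in> rot d e"
  using assms N_pos by (auto simp: rot_def divs_def even_divs_def carrier_iff dvd_mod_iff)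

lemma rot_sylow_disjoint: "rot_subgroups \<inter> sylow_subgroups = {}"
proof -
  have "rot d e \<noteq> sylow x" if "d \<in> divs" "e \<in> even_divs" "0 \<le> x" "x < N" for d e x
  proof
    assume "rot d e = sylow x"
    then have "(x, 1) \<in> rot d e" using sylow_mem that by simp
    then have "even (1::int)"
      using that(2) unfolding rot_def even_divs_def by (auto intro: dvd_trans)
    then show False by simp
  qed
  then show ?thesis by (force simp: rot_subgroups_def sylow_subgroups_def)
qed

lemma inj_sylow: "inj_on sylow {0..<N}"
proof (rule inj_onI)
  fix x z assume "x \<in> {0..<N}" "z \<in> {0..<N}" "sylow x = sylow z"
  then have "(x, 1) \<in> sylow z" using sylow_mem by auto
  then show "x = z" by (simp add: sylow_def)
qed

lemma inj_rot: "inj_on (\<lambda>(d, e). rot d e) (divs \<times> even_divs)"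
proof -
  have dvd: "d' dvd d \<and> e' dvd e"
    if "d \<in> divs" "e \<in> even_divs" "d' \<in> divs" "e' \<in> even_divs" "rot d e = rot d' e'" for d e d' e'
  proof -
    have "(d mod N, 0) \<in> rot d' e'" "(0, e mod 2 ^ k) \<in> rot d' e'"
      using rot_mem[OF that(1,2)] that(5) by auto
    then show ?thesis
      using that by (simp add: rot_def divs_def even_divs_def dvd_mod_iff)
  qed
  show ?thesis
  proof (rule inj_onI, clarify)
    fix d e d' e' assume *: "d \<in> divs" "e \<in> even_divs" "d' \<in> divs" "e' \<in> even_divs" "rot d e = rot d' e'"
    then have "d dvd d'" "d' dvd d" "e dvd e'" "e' dvd e"
      using dvd[of d e d' e'] dvd[of d' e' d e] by auto
    then show "d = d' \<and> e = e'"
      using * by (auto simp: divs_def even_divs_def intro: zdvd_antisym_nonneg)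
  qed
qed

text \<open>
  Moving an element \<open>(u, v)\<close> of \<open>rot d e\<close> past any group element changes at most the sign of \<open>u\<close>,
  that is, \<open>rot d e\<close> is normal.
\<close>

lemma rot_permutes:
  assumes C: "C \<in> rot_subgroups" and X: "X \<subseteq> carrier G"
  shows "C <#>\<^bsub>G\<^esub> X = X <#>\<^bsub>G\<^esub> C"
proof -
  obtain d e where d: "d \<in> divs" and e: "e \<in> even_divs" and CA: "C = rot d e"
    using C by (auto simp: rot_subgroups_def)
  have dN: "d dvd N" and e2: "2 dvd e" using d e by (auto simp: divs_def even_divs_def)
  show ?thesis
  proof
    show "C <#>\<^bsub>G\<^esub> X \<subseteq> X <#>\<^bsub>G\<^esub> C"
    proof
      fix g assume "g \<in> C <#>\<^bsub>G\<^esub> X"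
      then obtain u v x y where g: "g = (u, v) \<otimes>\<^bsub>G\<^esub> (x, y)" "(u, v) \<in> C" "(x, y) \<in> X"
        by (auto simp: set_mult_def)
      let ?u = "(if even y then u else - u) mod N"
      have "even v" using g(2) e2 by (auto simp: CA rot_def intro: dvd_trans)
      then have "g = (x, y) \<otimes>\<^bsub>G\<^esub> (?u, v)"
        by (auto simp: g(1) mult_eq mod_simps add.commute)
      moreover have "(?u, v) \<in> C"
        using g(2) dN N_pos by (auto simp: CA rot_def carrier_iff dvd_mod_iff)
      ultimately show "g \<in> X <#>\<^bsub>G\<^esub> C"
        using g(3) unfolding set_mult_def by blast
    qed
    show "X <#>\<^bsub>G\<^esub> C \<subseteq> C <#>\<^bsub>G\<^esub> X"
    proof
      fix g assume "g \<in> X <#>\<^bsub>G\<^esub> C"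
      then obtain u v x y where g: "g = (x, y) \<otimes>\<^bsub>G\<^esub> (u, v)" "(u, v) \<in> C" "(x, y) \<in> X"
        by (auto simp: set_mult_def)
      let ?u = "(if even y then u else - u) mod N"
      have "even v" using g(2) e2 by (auto simp: CA rot_def intro: dvd_trans)
      then have "g = (?u, v) \<otimes>\<^bsub>G\<^esub> (x, y)"
        by (auto simp: g(1) mult_eq mod_simps add.commute)
      moreover have "(?u, v) \<in> C"
        using g(2) dN N_pos by (auto simp: CA rot_def carrier_iff dvd_mod_iff)
      ultimately show "g \<in> C <#>\<^bsub>G\<^esub> X"
        using g(3) unfolding set_mult_def by blast
    qed
  qed
qed

text \<open>
  Elements of \<open>sylow z <#> sylow x\<close> with even second component have first component \<open>0\<close> or
  \<open>z - x\<close>. If the subgroups permute, the product \<open>(x, 1) \<otimes> (z, 1)\<close>, whose first component is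
  \<open>x - z\<close>, is of this form; so \<open>2 (x - z)\<close> vanishes modulo the odd number \<open>N\<close>.
\<close>

lemma sylow_permutes_imp_eq:
  assumes "C \<in> sylow_subgroups" "C' \<in> sylow_subgroups" and perm: "C <#>\<^bsub>G\<^esub> C' = C' <#>\<^bsub>G\<^esub> C"
  shows "C = C'"
proof -
  obtain x z where x: "0 \<le> x" "x < N" "C = sylow x" and z: "0 \<le> z" "z < N" "C' = sylow z"
    using assms(1,2) by (auto simp: sylow_subgroups_def)
  have "(x, 1) \<otimes>\<^bsub>G\<^esub> (z, 1) \<in> C <#>\<^bsub>G\<^esub> C'"
    using sylow_mem x z by (auto simp: set_mult_def)
  then have "(x, 1) \<otimes>\<^bsub>G\<^esub> (z, 1) \<in> sylow z <#>\<^bsub>G\<^esub> sylow x"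
    using perm x(3) z(3) by simp
  then obtain u v u' v' where uv: "(u, v) \<in> sylow z" "(u', v') \<in> sylow x"
      and eq: "(x, 1) \<otimes>\<^bsub>G\<^esub> (z, 1) = (u, v) \<otimes>\<^bsub>G\<^esub> (u', v')"
    by (auto simp only: set_mult_def)
  have eq1: "(x - z) mod N = (u + (if even v then u' else - u')) mod N"
    and eq2: "(1 + 1) mod 2 ^ k = (v + v') mod (2 ^ k :: int)"
    using eq by (simp_all add: mult_eq)
  have "even (v + v')"
    using eq2 even_mod_iff[of "v + v'"] even_mod_iff[of "1 + 1"] by simp
  then consider "even v" "even v'" | "odd v" "odd v'" by auto
  then have "N dvd 2 * (x - z)"
  proof cases
    case 1
    then have "(x - z) mod N = 0" using eq1 uv by (simp add: sylow_def)
    then show ?thesis by (simp only: mod_eq_0_iff_dvd dvd_mult)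
  next
    case 2
    then have "(x - z) mod N = (z - x) mod N" using eq1 uv by (simp add: sylow_def)
    then have "N dvd (x - z) - (z - x)" by (simp add: mod_eq_dvd_iff)
    moreover have "(x - z) - (z - x) = 2 * (x - z)" by simp
    ultimately show ?thesis by (rule back_subst)
  qed
  moreover have "coprime N 2" using N_odd by simp
  ultimately have "N dvd x - z"
    by (rule coprime_dvd_mult_right_iff[THEN iffD1, rotated])
  then have "x = z"
    using x z by (metis mod_eq_dvd_iff mod_pos_pos_trivial)
  then show ?thesis using x z by simp
qed

definition H :: "int \<Rightarrow> (int \<times> int) set" where
  "H t = {(x, y) \<in> carrier G. t dvd x}"

lemma subgroup_H:
  assumes t: "t dvd N"
  shows "subgroup (H t) G"
proof (rule subgroupI)
  show "H t \<subseteq> carrier G" by (auto simp: H_def)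
  show "H t \<noteq> {}" using N_pos by (auto simp: H_def carrier_iff intro!: exI[of _ 0])
  fix g assume g: "g \<in> H t"
  then have gG: "g \<in> carrier G" by (auto simp: H_def)
  have "inv\<^bsub>G\<^esub> g = inverse_elem g"
    using inverse_elem[OF gG] gG by (intro inv_equality)
  moreover have "inverse_elem g \<in> H t"
    using g t inverse_elem(1)[OF gG] by (auto simp: H_def inverse_elem_def dvd_mod_iff)
  ultimately show "inv\<^bsub>G\<^esub> g \<in> H t" by simp
  fix h assume h: "h \<in> H t"
  have "g \<otimes>\<^bsub>G\<^esub> h \<in> carrier G" using gG h by (auto simp: H_def)
  then show "g \<otimes>\<^bsub>G\<^esub> h \<in> H t"
    using g h t by (auto simp: H_def mult_eq dvd_mod_iff)
qed

lemma rot_subset_H_iff: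
  assumes "t dvd N" "d \<in> divs" "e \<in> even_divs"
  shows "rot d e \<subseteq> H t \<longleftrightarrow> t dvd d"
proof
  assume "rot d e \<subseteq> H t"
  then have "t dvd d mod N" using rot_mem(1)[OF assms(2,3)] by (auto simp: H_def)
  then show "t dvd d" using assms(1) by (simp add: dvd_mod_iff)
qed (auto simp: rot_def H_def intro: dvd_trans)

lemma sylow_subset_H_iff:
  assumes "0 \<le> x" "x < N"
  shows "sylow x \<subseteq> H t \<longleftrightarrow> t dvd x"
  using sylow_mem[OF assms] by (auto simp: sylow_def H_def)

lemma card_even_divs: "card even_divs = k"
proof -
  have "even_divs = {e. 0 < e \<and> e dvd 2 ^ k \<and> 2 ^ (k - (k - 1)) dvd e}"
    using k_pos by (auto simp: even_divs_def)
  then show ?thesis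
    using card_divisors_prime_power_above[of 2 "k - 1" k] k_pos by simp
qed

lemma csd_H:
  fixes s t :: int and \<tau> \<tau>' :: real
  assumes s: "0 < s" and t: "0 < t" and N: "N = t * s"
  defines "\<tau> \<equiv> real (card divs)" and "\<tau>' \<equiv> real (card {d \<in> divs. t dvd d})"
  shows "csd (H t) G = (k * \<tau>' * (k * \<tau> + N) + s * (k * \<tau> + 1)) / ((k * \<tau>' + s) * (k * \<tau> + N))"
proof -
  have tN: "t dvd N" using N by simp
  have "card rot_subgroups = card divs * k"
    unfolding rot_subgroups_def using inj_rot by (simp add: card_image card_cartesian_product card_even_divs)
  moreover have "card sylow_subgroups = nat N"
    unfolding sylow_subgroups_def using inj_sylow by (simp add: card_image)
  moreover have "card {C \<in> rot_subgroups. C \<subseteq> H t} = card {d \<in> divs. t dvd d} * k"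
  proof -
    have "{C \<in> rot_subgroups. C \<subseteq> H t} = (\<lambda>(d, e). rot d e) ` ({d \<in> divs. t dvd d} \<times> even_divs)"
      using rot_subset_H_iff[OF tN] by (auto simp: rot_subgroups_def)
    moreover have "inj_on (\<lambda>(d, e). rot d e) ({d \<in> divs. t dvd d} \<times> even_divs)"
      by (rule inj_on_subset[OF inj_rot]) auto
    ultimately show ?thesis
      by (simp add: card_image card_cartesian_product card_even_divs)
  qed
  moreover have "card {C \<in> sylow_subgroups. C \<subseteq> H t} = nat s"
  proof -
    have "{C \<in> sylow_subgroups. C \<subseteq> H t} = sylow ` {x \<in> {0..<N}. t dvd x}"
      using sylow_subset_H_iff by (auto simp: sylow_subgroups_def)
    moreover have "{x \<in> {0..<N}. t dvd x} = (*) t ` {0..<s}" (is "?L = ?R")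
    proof
      show "?L \<subseteq> ?R"
      proof
        fix x assume "x \<in> ?L"
        then obtain c where "x = t * c" "0 \<le> t * c" "t * c < t * s"
          by (auto simp: N)
        then show "x \<in> ?R"
          using t by (simp add: zero_le_mult_iff)
      qed
      show "?R \<subseteq> ?L" using t by (auto simp: N)
    qed
    moreover have "inj_on sylow {x \<in> {0..<N}. t dvd x}"
      by (rule inj_on_subset[OF inj_sylow]) auto
    moreover have "inj_on ((*) t) {0..<s}" using t by (auto simp: inj_on_def)
    ultimately show ?thesis by (simp add: card_image)
  qed
  ultimately have cards: "real (card rot_subgroups) = k * \<tau>" "real (card sylow_subgroups) = N"
      "real (card {C \<in> rot_subgroups. C \<subseteq> H t}) = k * \<tau>'" "real (card {C \<in> sylow_subgroups. C \<subseteq> H t}) = s"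
    using N_pos s by (simp_all add: \<tau>_def \<tau>'_def)
  have "C <#>\<^bsub>G\<^esub> C' = C' <#>\<^bsub>G\<^esub> C" if "C \<in> rot_subgroups" "C' \<in> cyclic_subgroups G" for C C'
    using that by (intro rot_permutes) (auto simp: cyclic_subgroups_def dest: subgroup.subset)
  note csd_of_permuting_split[OF group_G finite_carrier subgroup_H[OF tN] cyclic_subgroups_G
      rot_sylow_disjoint this sylow_permutes_imp_eq]
  then show ?thesis
    unfolding cards .
qed

end

section \<open>Limits of the values\<close>

lemma csd_values_formula:
  fixes a b k :: nat
  assumes "a \<le> b" "0 < k"
  shows "(real k * (real a + 1) * (real k * (real b + 1) + 3 ^ b) + 3 ^ a * (real k * (real b + 1) + 1)) /
     ((real k * (real a + 1) + 3 ^ a) * (real k * (real b + 1) + 3 ^ b)) \<in> csd_values" (is "?X \<in> _")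
proof -
  interpret inversion_extension "3 ^ b" k
    using assms by unfold_locales auto
  have N: "(3::int) ^ b = 3 ^ (b - a) * 3 ^ a"
    using assms by (simp flip: power_add)
  have "card divs = b + 1"
    using card_divisors_prime_power_above[of 3 b b] by (simp add: divs_def)
  moreover have "card {d \<in> divs. 3 ^ (b - a) dvd d} = a + 1"
    using card_divisors_prime_power_above[of 3 a b] assms(1) by (simp add: divs_def conj_assoc)
  ultimately have "csd (H (3 ^ (b - a))) G = ?X"
    using csd_H[OF _ _ N] by (simp add: add.commute)
  moreover have "csd (H (3 ^ (b - a))) G \<in> csd_values"
    using N by (intro csd_in_csd_values group_G finite_carrier subgroup_H) simp
  ultimately show ?thesis by simp
qed

text \<open>
  The value in \<open>csd_values_formula\<close> splits into its limit and a multiple of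
  \<open>(k (b + 1) + 1) / (k (b + 1) + 3 ^ b)\<close>, the proportion of cyclic subgroups of the large group that
  permute with a given Sylow 2-subgroup.
\<close>

lemma ratio_in_closure:
  fixes a k :: nat
  assumes "0 < k"
  shows "real k * (real a + 1) / (real k * (real a + 1) + 3 ^ a) \<in> closure csd_values"
proof -
  define p where "p = real k * (real a + 1)"
  define q where "q b = real k * (real b + 1) + 3 ^ b" for b :: nat
  define w where "w b = real k * (real b + 1) + 1" for b :: nat
  define f where "f b = (p * q b + 3 ^ a * w b) / ((p + 3 ^ a) * q b)" for b
  have "p > 0" using assms by (simp add: p_def)
  have small: "(\<lambda>b. w b / q b) \<longlonglongrightarrow> 0"
    using assms unfolding w_def q_def by real_asymp
  have f_eq: "f = (\<lambda>b. p / (p + 3 ^ a) + 3 ^ a / (p + 3 ^ a) * (w b / q b))"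
  proof
    fix b
    have "q b > 0" by (simp add: q_def add_nonneg_pos)
    moreover have "p + 3 ^ a > 0" using \<open>p > 0\<close> by (simp add: add_pos_pos)
    ultimately show "f b = p / (p + 3 ^ a) + 3 ^ a / (p + 3 ^ a) * (w b / q b)"
      by (simp add: f_def add_divide_distrib)
  qed
  have "f \<longlonglongrightarrow> p / (p + 3 ^ a) + 3 ^ a / (p + 3 ^ a) * 0"
    unfolding f_eq by (intro tendsto_intros small)
  \<comment> \<open>The index is shifted because \<open>f b\<close> is the degree of a subgroup only for \<open>a \<le> b\<close>.\<close>
  then have "(\<lambda>b. f (b + a)) \<longlonglongrightarrow> p / (p + 3 ^ a)"
    using LIMSEQ_ignore_initial_segment by fastforce
  moreover have "f (b + a) \<in> csd_values" for b
    using csd_values_formula[of a "b + a" k] assms unfolding f_def p_def q_def w_def by simp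
  ultimately have "p / (p + 3 ^ a) \<in> closure csd_values"
    unfolding closure_sequential by (intro exI[of _ "\<lambda>b. f (b + a)"]) auto
  then show ?thesis unfolding p_def .
qed

lemma open_unit_interval_in_closure:
  fixes r :: real
  assumes r: "0 < r" "r < 1"
  shows "r \<in> closure csd_values"
proof -
  \<comment> \<open>\<open>q\<close> is the preimage of \<open>r\<close> under \<open>u \<mapsto> u / (u + 1)\<close>, and \<open>k a\<close> is the least \<open>k\<close> for which
    \<open>k (a + 1) / 3 ^ a\<close> is at least \<open>q\<close>.\<close>
  define q where "q = r / (1 - r)"
  have q: "q > 0" using r by (simp add: q_def)
  define k where "k a = nat \<lceil>q * 3 ^ a / (a + 1)\<rceil>" for a :: nat
  define u where "u a = k a * (a + 1) / 3 ^ a" for a :: nat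
  have k_pos: "0 < k a" for a
    using q by (simp add: k_def)
  have u_bounds: "q \<le> u a \<and> u a \<le> q + (real a + 1) / 3 ^ a" for a
  proof -
    have "0 \<le> q * 3 ^ a / (a + 1)" using q by simp
    then have "q * 3 ^ a / (a + 1) \<le> k a" "k a \<le> q * 3 ^ a / (a + 1) + 1"
      unfolding k_def by linarith+
    then have "q * 3 ^ a \<le> k a * (a + 1)" "k a * (a + 1) \<le> q * 3 ^ a + (real a + 1)"
      by (simp_all add: field_simps)
    then have "q * 3 ^ a / 3 ^ a \<le> u a" "u a \<le> (q * 3 ^ a + (real a + 1)) / 3 ^ a"
      unfolding u_def by (intro divide_right_mono; simp)+
    then show ?thesis
      by (simp add: add_divide_distrib)
  qed
  have "(\<lambda>a. q + (real a + 1) / 3 ^ a) \<longlonglongrightarrow> q" by real_asymp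
  then have "u \<longlonglongrightarrow> q"
    using u_bounds by (intro tendsto_sandwich[of "\<lambda>_. q" u]) auto
  then have lim: "(\<lambda>a. u a / (u a + 1)) \<longlonglongrightarrow> q / (q + 1)"
    using q by (intro tendsto_intros) auto
  have q_eq: "q / (q + 1) = r"
    using r by (simp add: q_def field_simps)
  have mem: "u a / (u a + 1) \<in> closure csd_values" for a
  proof -
    define X where "X = real (k a) * (real a + 1)"
    have u: "u a = X / 3 ^ a" by (simp add: u_def X_def algebra_simps)
    have "u a + 1 = (X + 3 ^ a) / 3 ^ a" by (simp add: u add_divide_distrib)
    then have "u a / (u a + 1) = X / (X + 3 ^ a)"
      unfolding u by simp
    then show ?thesis
      using ratio_in_closure[OF k_pos[of a], of a] by (simp only: X_def)
  qed
  show ?thesis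
    using closed_sequentially[OF closed_closure mem lim] unfolding q_eq .
qed

theorem theorem4p1:
  shows "csd_values \<subseteq> {0..1} \<and> {0..1} \<subseteq> closure csd_values"
proof
  show "csd_values \<subseteq> {0..1}"
    unfolding csd_values_def using csd_bounds by blast
  have "{0<..<1::real} \<subseteq> closure csd_values"
    using open_unit_interval_in_closure by auto
  then have "closure {0<..<1::real} \<subseteq> closure csd_values"
    using closed_closure by (rule closure_minimal)
  then show "{0..1} \<subseteq> closure csd_values"
    unfolding closure_greaterThanLessThan[OF zero_less_one] .
qed

end
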